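(* Let $f:R_{1}\rightarrow R_{2}$ be a surjective ring homomorphism, $J$ an ideal of $R_{2}$, $M_{1}$ an $R_{1}$-module, $M_{2}$ an $R_{2}$-module (regarded as an $R_{1}$-module via $f$), and $\varphi:M_{1}\rightarrow M_{2}$ a surjective $R_{1}$-module homomorphism. Consider the $(R_{1}\Join^{f}J)$-module $M_{1}\Join^{\varphi}JM_{2}$ and let $N_{2}$ be a submodule of $M_{2}$. Then: (1) $N_{2}$ is a prime submodule of $M_{2}$ if and only if $\overline{N_{2}}^{\varphi}$ is a prime submodule of $M_{1}\Join^{\varphi}JM_{2}$. (2) If $\overline{N_{2}}^{\varphi}$ is a prime submodule of $M_{1}\Join^{\varphi}JM_{2}$ and $J\nsubseteq(N_{2}:_{R_{2}}M_{2})$, then $(N_{2}:_{M_{2}}J)$ is a prime submodule of $M_{2}$.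
   Context: Rings are commutative with non-zero identity and modules are unital. For a submodule $N$ of an $R$-module $M$, $(N:_{R}M)=\{r\in R: rM\subseteq N\}$; for an ideal $J$ of $R$, $(N:_{M}J)=\{m\in M: Jm\subseteq N\}$. Amalgamation: $R_{1}\Join^{f}J=\{(r,f(r)+j):r\in R_{1},j\in J\}$, a subring of $R_{1}\times R_{2}$. $M_{1}\Join^{\varphi}JM_{2}=\{(m_{1},\varphi(m_{1})+m_{2}):m_{1}\in M_{1},m_{2}\in JM_{2}\}$ is an $(R_{1}\Join^{f}J)$-module with scalar product $(r,f(r)+j)(m_{1},\varphi(m_{1})+m_{2})=(rm_{1},\varphi(rm_{1})+f(r)m_{2}+j\varphi(m_{1})+jm_{2})$. For a submodule $N_{2}$ of $M_{2}$, $\overline{N_{2}}^{\varphi}=\{(m_{1},\varphi(m_{1})+m_{2})\in M_{1}\Join^{\varphi}JM_{2}:\varphi(m_{1})+m_{2}\in N_{2}\}$. A proper submodule $N$ of an $R$-module $M$ is prime if for all $r\in R$, $m\in M$ with $rm\in N$, either $r\in(N:_{R}M)$ or $m\in N$. *)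

theory Defs
  imports "HOL-Algebra.Algebra"
begin

definition restrict_scalars ::
    "('a \<Rightarrow> 'b) \<Rightarrow> ('b, 'c, 'm) module_scheme \<Rightarrow> ('a, 'c) module"
  where "restrict_scalars f M =
    ring.extend (ring.truncate M) (module.fields (\<lambda>r x. f r \<odot>\<^bsub>M\<^esub> x))"

definition mod_hom ::
    "('a, 'k) ring_scheme \<Rightarrow> ('a, 'b, 'm) module_scheme \<Rightarrow> ('a, 'c, 'n) module_scheme
      \<Rightarrow> ('b \<Rightarrow> 'c) set"
  where "mod_hom R M N =
    {h \<in> hom (add_monoid M) (add_monoid N).
      \<forall>r \<in> carrier R. \<forall>x \<in> carrier M. h (r \<odot>\<^bsub>M\<^esub> x) = r \<odot>\<^bsub>N\<^esub> h x}"

(* Finite sums of elements j x; closure under addition is enough when J is an ideal, since then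
   J contains 0 and is closed under scalar multiples. *)
inductive_set ideal_smult :: "'a set \<Rightarrow> ('a, 'b, 'm) module_scheme \<Rightarrow> 'b set"
  for J and M where
    smult: "\<lbrakk> j \<in> J; x \<in> carrier M \<rbrakk> \<Longrightarrow> j \<odot>\<^bsub>M\<^esub> x \<in> ideal_smult J M"
  | sum: "\<lbrakk> x \<in> ideal_smult J M; y \<in> ideal_smult J M \<rbrakk> \<Longrightarrow> x \<oplus>\<^bsub>M\<^esub> y \<in> ideal_smult J M"

definition ring_colon ::
    "('a, 'k) ring_scheme \<Rightarrow> ('a, 'b, 'm) module_scheme \<Rightarrow> 'b set \<Rightarrow> 'a set"
  where "ring_colon R M N = {r \<in> carrier R. \<forall>x \<in> carrier M. r \<odot>\<^bsub>M\<^esub> x \<in> N}"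

definition module_colon :: "('a, 'b, 'm) module_scheme \<Rightarrow> 'b set \<Rightarrow> 'a set \<Rightarrow> 'b set"
  where "module_colon M N J = {x \<in> carrier M. \<forall>j \<in> J. j \<odot>\<^bsub>M\<^esub> x \<in> N}"

definition prime_submodule ::
    "'b set \<Rightarrow> ('a, 'k) ring_scheme \<Rightarrow> ('a, 'b, 'm) module_scheme \<Rightarrow> bool"
  where "prime_submodule N R M \<longleftrightarrow>
    submodule N R M \<and> N \<noteq> carrier M \<and>
    (\<forall>r \<in> carrier R. \<forall>x \<in> carrier M. r \<odot>\<^bsub>M\<^esub> x \<in> N \<longrightarrow> r \<in> ring_colon R M N \<or> x \<in> N)"

definition amalg_ring ::
    "('a, 'k) ring_scheme \<Rightarrow> ('b, 'l) ring_scheme \<Rightarrow> ('a \<Rightarrow> 'b) \<Rightarrow> 'b set \<Rightarrow> ('a \<times> 'b) ring"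
  where "amalg_ring R1 R2 f J =
    RDirProd R1 R2 \<lparr> carrier := {(r, f r \<oplus>\<^bsub>R2\<^esub> j) | r j. r \<in> carrier R1 \<and> j \<in> J} \<rparr>"

(* The scalar product is given on (r, f r + j) and (x1, phi x1 + x2). For a scalar (r, s) and an
   element (x1, y) these j and x2 are recovered as s - f r and y - phi x1; see
   amalg_module_smult. The multiplicative fields inherited from RDirProd play no role. *)
definition amalg_module ::
    "('b, 'l) ring_scheme \<Rightarrow> ('a, 'c, 'm) module_scheme \<Rightarrow> ('b, 'd, 'n) module_scheme
      \<Rightarrow> ('a \<Rightarrow> 'b) \<Rightarrow> 'b set \<Rightarrow> ('c \<Rightarrow> 'd) \<Rightarrow> ('a \<times> 'b, 'c \<times> 'd) module"
  where "amalg_module R2 M1 M2 f J \<phi> =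
    ring.extend
      (RDirProd M1 M2 \<lparr> carrier :=
        {(x1, \<phi> x1 \<oplus>\<^bsub>M2\<^esub> x2) | x1 x2. x1 \<in> carrier M1 \<and> x2 \<in> ideal_smult J M2} \<rparr>)
      (module.fields (\<lambda>(r, s) (x1, y).
        let j = s \<ominus>\<^bsub>R2\<^esub> f r; x2 = y \<ominus>\<^bsub>M2\<^esub> \<phi> x1 in
        (r \<odot>\<^bsub>M1\<^esub> x1,
         \<phi> (r \<odot>\<^bsub>M1\<^esub> x1) \<oplus>\<^bsub>M2\<^esub> f r \<odot>\<^bsub>M2\<^esub> x2 \<oplus>\<^bsub>M2\<^esub> j \<odot>\<^bsub>M2\<^esub> \<phi> x1 \<oplus>\<^bsub>M2\<^esub> j \<odot>\<^bsub>M2\<^esub> x2)))"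

definition amalg_submodule ::
    "('b, 'l) ring_scheme \<Rightarrow> ('a, 'c, 'm) module_scheme \<Rightarrow> ('b, 'd, 'n) module_scheme
      \<Rightarrow> ('a \<Rightarrow> 'b) \<Rightarrow> 'b set \<Rightarrow> ('c \<Rightarrow> 'd) \<Rightarrow> 'd set \<Rightarrow> ('c \<times> 'd) set"
  where "amalg_submodule R2 M1 M2 f J \<phi> N2 =
    {(x1, y). (x1, y) \<in> carrier (amalg_module R2 M1 M2 f J \<phi>) \<and> y \<in> N2}"


lemma amalg_ring_simps:
  "carrier (amalg_ring R1 R2 f J) = {(r, f r \<oplus>\<^bsub>R2\<^esub> j) | r j. r \<in> carrier R1 \<and> j \<in> J}"
  "(r, s) \<oplus>\<^bsub>amalg_ring R1 R2 f J\<^esub> (r', s') = (r \<oplus>\<^bsub>R1\<^esub> r', s \<oplus>\<^bsub>R2\<^esub> s')"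
  "(r, s) \<otimes>\<^bsub>amalg_ring R1 R2 f J\<^esub> (r', s') = (r \<otimes>\<^bsub>R1\<^esub> r', s \<otimes>\<^bsub>R2\<^esub> s')"
  "\<one>\<^bsub>amalg_ring R1 R2 f J\<^esub> = (\<one>\<^bsub>R1\<^esub>, \<one>\<^bsub>R2\<^esub>)"
  "\<zero>\<^bsub>amalg_ring R1 R2 f J\<^esub> = (\<zero>\<^bsub>R1\<^esub>, \<zero>\<^bsub>R2\<^esub>)"
  by (auto simp: amalg_ring_def RDirProd_def DirProd_def monoid.defs)

lemma amalg_module_simps:
  "carrier (amalg_module R2 M1 M2 f J \<phi>) =
    {(x1, \<phi> x1 \<oplus>\<^bsub>M2\<^esub> x2) | x1 x2. x1 \<in> carrier M1 \<and> x2 \<in> ideal_smult J M2}"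
  "(x, y) \<oplus>\<^bsub>amalg_module R2 M1 M2 f J \<phi>\<^esub> (x', y') = (x \<oplus>\<^bsub>M1\<^esub> x', y \<oplus>\<^bsub>M2\<^esub> y')"
  "\<zero>\<^bsub>amalg_module R2 M1 M2 f J \<phi>\<^esub> = (\<zero>\<^bsub>M1\<^esub>, \<zero>\<^bsub>M2\<^esub>)"
  by (auto simp: amalg_module_def RDirProd_def DirProd_def monoid.defs ring.defs module.defs)

locale amalg_setup =
  f: ring_hom_cring R1 R2 f + J: ideal J R2 + M1: module R1 M1 + M2: module R2 M2
  for R1 :: "('a, 'k) ring_scheme" and R2 :: "('b, 'l) ring_scheme" and f J
    and M1 :: "('a, 'c, 'm) module_scheme" and M2 :: "('b, 'd, 'n) module_scheme" +
  fixes \<phi>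
  assumes phi: "\<phi> \<in> mod_hom R1 M1 (restrict_scalars f M2)"
begin

lemma phi_closed: "x \<in> carrier M1 \<Longrightarrow> \<phi> x \<in> carrier M2"
  and phi_add: "x \<in> carrier M1 \<Longrightarrow> y \<in> carrier M1 \<Longrightarrow> \<phi> (x \<oplus>\<^bsub>M1\<^esub> y) = \<phi> x \<oplus>\<^bsub>M2\<^esub> \<phi> y"
  and phi_smult: "r \<in> carrier R1 \<Longrightarrow> x \<in> carrier M1 \<Longrightarrow> \<phi> (r \<odot>\<^bsub>M1\<^esub> x) = f r \<odot>\<^bsub>M2\<^esub> \<phi> x"
  using phi by (auto simp: mod_hom_def restrict_scalars_def hom_def ring.defs module.defs)

lemma ideal_smult_carrier: "x \<in> ideal_smult J M2 \<Longrightarrow> x \<in> carrier M2"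
  by (induction rule: ideal_smult.induct) (auto intro: J.Icarr)

lemma ideal_smult_smult:
  assumes "x \<in> ideal_smult J M2" "s \<in> carrier R2"
  shows "s \<odot>\<^bsub>M2\<^esub> x \<in> ideal_smult J M2"
  using assms
proof (induction rule: ideal_smult.induct)
  case (smult j x)
  then have "s \<odot>\<^bsub>M2\<^esub> (j \<odot>\<^bsub>M2\<^esub> x) = (s \<otimes>\<^bsub>R2\<^esub> j) \<odot>\<^bsub>M2\<^esub> x"
    by (simp add: M2.smult_assoc1 J.Icarr)
  with smult show ?case by (simp add: J.I_l_closed ideal_smult.smult)
next
  case (sum x y)
  then show ?case
    by (simp add: M2.smult_r_distr ideal_smult_carrier ideal_smult.sum)
qed

lemma amalg_smult_component:
  assumes r: "r \<in> carrier R1" and s: "s \<in> carrier R2"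
    and x: "x \<in> carrier M1" and y: "y \<in> carrier M2"
  shows "(r, s) \<odot>\<^bsub>amalg_module R2 M1 M2 f J \<phi>\<^esub> (x, y) = (r \<odot>\<^bsub>M1\<^esub> x, s \<odot>\<^bsub>M2\<^esub> y)"
proof -
  define j where "j = s \<ominus>\<^bsub>R2\<^esub> f r"
  define z where "z = y \<ominus>\<^bsub>M2\<^esub> \<phi> x"
  have c: "f r \<in> carrier R2" "\<phi> x \<in> carrier M2" "j \<in> carrier R2" "z \<in> carrier M2"
    using assms by (auto simp: j_def z_def phi_closed)
  have sj: "s = f r \<oplus>\<^bsub>R2\<^esub> j" and yz: "y = \<phi> x \<oplus>\<^bsub>M2\<^esub> z"
    using s y c(1,2) unfolding j_def z_def a_minus_def
    by (metis f.S.add.inv_closed f.S.add.m_lcomm f.S.r_neg f.S.r_zero,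
        metis M2.M.add.inv_closed M2.M.add.m_lcomm M2.M.r_neg M2.M.r_zero)
  have "s \<odot>\<^bsub>M2\<^esub> y = \<phi> (r \<odot>\<^bsub>M1\<^esub> x) \<oplus>\<^bsub>M2\<^esub> f r \<odot>\<^bsub>M2\<^esub> z \<oplus>\<^bsub>M2\<^esub> j \<odot>\<^bsub>M2\<^esub> \<phi> x \<oplus>\<^bsub>M2\<^esub> j \<odot>\<^bsub>M2\<^esub> z"
    unfolding sj yz using c r x
    by (simp add: M2.smult_l_distr M2.smult_r_distr phi_smult M2.M.add.m_ac)
  then show ?thesis
    by (simp add: amalg_module_def ring.defs module.defs Let_def j_def z_def)
qed

lemma amalg_module_smult:
  assumes r: "r \<in> carrier R1" and j: "j \<in> J"
    and x1: "x1 \<in> carrier M1" and x2: "x2 \<in> ideal_smult J M2"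
  shows "(r, f r \<oplus>\<^bsub>R2\<^esub> j) \<odot>\<^bsub>amalg_module R2 M1 M2 f J \<phi>\<^esub> (x1, \<phi> x1 \<oplus>\<^bsub>M2\<^esub> x2) =
    (r \<odot>\<^bsub>M1\<^esub> x1,
     \<phi> (r \<odot>\<^bsub>M1\<^esub> x1) \<oplus>\<^bsub>M2\<^esub> f r \<odot>\<^bsub>M2\<^esub> x2 \<oplus>\<^bsub>M2\<^esub> j \<odot>\<^bsub>M2\<^esub> \<phi> x1 \<oplus>\<^bsub>M2\<^esub> j \<odot>\<^bsub>M2\<^esub> x2)"
proof -
  have c: "j \<in> carrier R2" "x2 \<in> carrier M2" "\<phi> x1 \<in> carrier M2" "f r \<in> carrier R2"
    using assms by (auto simp: J.Icarr ideal_smult_carrier phi_closed)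
  then show ?thesis using r x1
    by (simp add: amalg_smult_component M2.smult_l_distr M2.smult_r_distr phi_smult
        M2.M.add.m_ac)
qed

lemma amalg_ring_carrier_iff:
  "(r, s) \<in> carrier (amalg_ring R1 R2 f J) \<longleftrightarrow>
    r \<in> carrier R1 \<and> s \<in> carrier R2 \<and> s \<ominus>\<^bsub>R2\<^esub> f r \<in> J"
proof -
  have "s = f r \<oplus>\<^bsub>R2\<^esub> (s \<ominus>\<^bsub>R2\<^esub> f r)" if "r \<in> carrier R1" "s \<in> carrier R2"
    using that unfolding a_minus_def
    by (metis f.S.add.inv_closed f.S.add.m_lcomm f.S.r_neg f.S.r_zero f.hom_closed)
  moreover have "(f r \<oplus>\<^bsub>R2\<^esub> j) \<ominus>\<^bsub>R2\<^esub> f r = j" if "r \<in> carrier R1" "j \<in> J" for j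
    using that J.Icarr[of j] unfolding a_minus_def
    by (metis f.S.add.inv_closed f.S.add.m_assoc f.S.add.m_comm f.S.r_neg f.S.r_zero f.hom_closed)
  ultimately show ?thesis
    by (fastforce simp: amalg_ring_simps intro: J.Icarr)
qed

lemma zero_in_ideal_smult: "\<zero>\<^bsub>M2\<^esub> \<in> ideal_smult J M2"
proof -
  have "\<zero>\<^bsub>R2\<^esub> \<odot>\<^bsub>M2\<^esub> \<zero>\<^bsub>M2\<^esub> \<in> ideal_smult J M2"
    by (intro ideal_smult.smult J.zero_closed M2.M.zero_closed)
  then show ?thesis by simp
qed

lemma ideal_smult_submodule: "submodule (ideal_smult J M2) R2 M2"
proof (rule M2.submoduleI)
  show "\<ominus>\<^bsub>M2\<^esub> a \<in> ideal_smult J M2" if "a \<in> ideal_smult J M2" for a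
  proof -
    have "(\<ominus>\<^bsub>R2\<^esub> \<one>\<^bsub>R2\<^esub>) \<odot>\<^bsub>M2\<^esub> a \<in> ideal_smult J M2"
      using that by (simp add: ideal_smult_smult)
    then show ?thesis using that by (simp add: M2.smult_l_minus ideal_smult_carrier)
  qed
qed (auto simp: ideal_smult_carrier zero_in_ideal_smult ideal_smult_smult intro: ideal_smult.sum)

lemma amalg_module_carrier_iff:
  "(x, y) \<in> carrier (amalg_module R2 M1 M2 f J \<phi>) \<longleftrightarrow>
    x \<in> carrier M1 \<and> y \<in> carrier M2 \<and> y \<ominus>\<^bsub>M2\<^esub> \<phi> x \<in> ideal_smult J M2"
proof -
  have "y = \<phi> x \<oplus>\<^bsub>M2\<^esub> (y \<ominus>\<^bsub>M2\<^esub> \<phi> x)" if "x \<in> carrier M1" "y \<in> carrier M2"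
    using that unfolding a_minus_def
    by (metis M2.M.add.inv_closed M2.M.add.m_lcomm M2.M.r_neg M2.M.r_zero phi_closed)
  moreover have "(\<phi> x \<oplus>\<^bsub>M2\<^esub> z) \<ominus>\<^bsub>M2\<^esub> \<phi> x = z"
    if "x \<in> carrier M1" "z \<in> ideal_smult J M2" for z
    using that ideal_smult_carrier[of z] unfolding a_minus_def
    by (metis M2.M.add.inv_closed M2.M.add.m_assoc M2.M.add.m_comm M2.M.r_neg M2.M.r_zero phi_closed)
  ultimately show ?thesis
    by (fastforce simp: amalg_module_simps ideal_smult_carrier phi_closed)
qed

lemma amalg_ring_subring: "subring (carrier (amalg_ring R1 R2 f J)) (RDirProd R1 R2)"
proof (rule ring.subringI[OF RDirProd_ring])
  let ?P = "RDirProd R1 R2"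
  show "ring R1" "ring R2" by (rule f.R.ring_axioms, rule f.S.ring_axioms)
  then interpret P: ring ?P by (rule RDirProd_ring)
  have add: "(r, s) \<oplus>\<^bsub>?P\<^esub> (r', s') = (r \<oplus>\<^bsub>R1\<^esub> r', s \<oplus>\<^bsub>R2\<^esub> s')"
    and mult: "(r, s) \<otimes>\<^bsub>?P\<^esub> (r', s') = (r \<otimes>\<^bsub>R1\<^esub> r', s \<otimes>\<^bsub>R2\<^esub> s')"
    and zero: "\<zero>\<^bsub>?P\<^esub> = (\<zero>\<^bsub>R1\<^esub>, \<zero>\<^bsub>R2\<^esub>)" and one: "\<one>\<^bsub>?P\<^esub> = (\<one>\<^bsub>R1\<^esub>, \<one>\<^bsub>R2\<^esub>)"
    for r s r' s' by (auto simp: RDirProd_def DirProd_def monoid.defs)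
  show "carrier (amalg_ring R1 R2 f J) \<subseteq> carrier ?P"
    by (auto simp: RDirProd_carrier amalg_ring_carrier_iff)
  show "\<one>\<^bsub>?P\<^esub> \<in> carrier (amalg_ring R1 R2 f J)"
    by (simp add: one amalg_ring_carrier_iff a_minus_def f.S.r_neg)
  fix a b assume a: "a \<in> carrier (amalg_ring R1 R2 f J)" and b: "b \<in> carrier (amalg_ring R1 R2 f J)"
  obtain r j where a': "a = (r, f r \<oplus>\<^bsub>R2\<^esub> j)" "r \<in> carrier R1" "j \<in> J"
    using a by (auto simp: amalg_ring_simps)
  obtain r' j' where b': "b = (r', f r' \<oplus>\<^bsub>R2\<^esub> j')" "r' \<in> carrier R1" "j' \<in> J"
    using b by (auto simp: amalg_ring_simps)
  have c: "j \<in> carrier R2" "j' \<in> carrier R2" using a' b' by (auto intro: J.Icarr)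
  have "\<ominus>\<^bsub>?P\<^esub> a = (\<ominus>\<^bsub>R1\<^esub> r, f (\<ominus>\<^bsub>R1\<^esub> r) \<oplus>\<^bsub>R2\<^esub> (\<ominus>\<^bsub>R2\<^esub> j))"
    using a' c by (intro P.minus_equality)
      (auto simp: add zero RDirProd_carrier f.R.l_neg f.S.minus_add[symmetric] f.S.l_neg)
  then show "\<ominus>\<^bsub>?P\<^esub> a \<in> carrier (amalg_ring R1 R2 f J)"
    using a' J.a_inv_closed by (auto simp: amalg_ring_simps)
  have "a \<oplus>\<^bsub>?P\<^esub> b = (r \<oplus>\<^bsub>R1\<^esub> r', f (r \<oplus>\<^bsub>R1\<^esub> r') \<oplus>\<^bsub>R2\<^esub> (j \<oplus>\<^bsub>R2\<^esub> j'))"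
    using a' b' c by (simp add: add f.S.add.m_ac)
  then show "a \<oplus>\<^bsub>?P\<^esub> b \<in> carrier (amalg_ring R1 R2 f J)"
    using a' b' by (auto simp: amalg_ring_simps)
  have "a \<otimes>\<^bsub>?P\<^esub> b =
      (r \<otimes>\<^bsub>R1\<^esub> r', f (r \<otimes>\<^bsub>R1\<^esub> r') \<oplus>\<^bsub>R2\<^esub> (f r \<otimes>\<^bsub>R2\<^esub> j' \<oplus>\<^bsub>R2\<^esub> j \<otimes>\<^bsub>R2\<^esub> (f r' \<oplus>\<^bsub>R2\<^esub> j')))"
    using a' b' c by (simp add: mult f.S.l_distr f.S.r_distr f.S.add.m_ac)
  moreover have "f r \<otimes>\<^bsub>R2\<^esub> j' \<oplus>\<^bsub>R2\<^esub> j \<otimes>\<^bsub>R2\<^esub> (f r' \<oplus>\<^bsub>R2\<^esub> j') \<in> J"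
    using a' b' c by (simp add: J.I_l_closed J.I_r_closed)
  ultimately show "a \<otimes>\<^bsub>?P\<^esub> b \<in> carrier (amalg_ring R1 R2 f J)"
    using a' b' by (auto simp: amalg_ring_simps)
qed

lemma amalg_ring_cring: "cring (amalg_ring R1 R2 f J)"
proof -
  have "ring (RDirProd R1 R2 \<lparr> carrier := carrier (amalg_ring R1 R2 f J) \<rparr>)"
    using ring.subring_is_ring[OF RDirProd_ring amalg_ring_subring]
      f.R.ring_axioms f.S.ring_axioms by blast
  then have "ring (amalg_ring R1 R2 f J)" by (simp add: amalg_ring_def)
  then show ?thesis
    by (intro cring.intro comm_monoid.intro comm_monoid_axioms.intro ring.is_monoid)
      (auto simp: amalg_ring_carrier_iff amalg_ring_simps(2-) f.R.m_comm f.S.m_comm)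
qed

lemma amalg_module_module:
  "module (amalg_ring R1 R2 f J) (amalg_module R2 M1 M2 f J \<phi>)"
proof (rule moduleI)
  let ?A = "amalg_ring R1 R2 f J" and ?M = "amalg_module R2 M1 M2 f J \<phi>"
  have add_closed: "a \<oplus>\<^bsub>?M\<^esub> b \<in> carrier ?M" if ma: "a \<in> carrier ?M" and mb: "b \<in> carrier ?M" for a b
  proof -
    obtain x z where a: "a = (x, \<phi> x \<oplus>\<^bsub>M2\<^esub> z)" "x \<in> carrier M1" "z \<in> ideal_smult J M2"
      using ma by (auto simp: amalg_module_simps)
    obtain x' z' where b: "b = (x', \<phi> x' \<oplus>\<^bsub>M2\<^esub> z')" "x' \<in> carrier M1" "z' \<in> ideal_smult J M2"
      using mb by (auto simp: amalg_module_simps)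
    have "a \<oplus>\<^bsub>?M\<^esub> b = (x \<oplus>\<^bsub>M1\<^esub> x', \<phi> (x \<oplus>\<^bsub>M1\<^esub> x') \<oplus>\<^bsub>M2\<^esub> (z \<oplus>\<^bsub>M2\<^esub> z'))"
      using a b
      by (simp add: amalg_module_simps(2) phi_add phi_closed ideal_smult_carrier M2.M.add.m_ac)
    then show ?thesis using a b by (auto simp: amalg_module_simps(1) intro: ideal_smult.sum)
  qed
  have phi_zero: "\<phi> \<zero>\<^bsub>M1\<^esub> = \<zero>\<^bsub>M2\<^esub>"
    using phi_smult[of "\<zero>\<^bsub>R1\<^esub>" "\<zero>\<^bsub>M1\<^esub>"] by (simp add: phi_closed)
  have phi_neg: "\<phi> (\<ominus>\<^bsub>M1\<^esub> x) = \<ominus>\<^bsub>M2\<^esub> \<phi> x" if "x \<in> carrier M1" for x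
    using phi_smult[of "\<ominus>\<^bsub>R1\<^esub> \<one>\<^bsub>R1\<^esub>" x] that
    by (simp add: M1.smult_l_minus M2.smult_l_minus phi_closed)
  show "cring ?A" by (rule amalg_ring_cring)
  show "abelian_group ?M"
  proof (rule abelian_groupI)
    show "\<zero>\<^bsub>?M\<^esub> \<in> carrier ?M"
      by (simp add: amalg_module_simps(3) amalg_module_carrier_iff phi_zero a_minus_def
          M2.M.r_neg zero_in_ideal_smult)
    show "\<exists>b\<in>carrier ?M. b \<oplus>\<^bsub>?M\<^esub> a = \<zero>\<^bsub>?M\<^esub>" if ma: "a \<in> carrier ?M" for a
    proof -
      obtain x z where a: "a = (x, \<phi> x \<oplus>\<^bsub>M2\<^esub> z)" "x \<in> carrier M1" "z \<in> ideal_smult J M2"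
        using ma by (auto simp: amalg_module_simps)
      let ?b = "(\<ominus>\<^bsub>M1\<^esub> x, \<phi> (\<ominus>\<^bsub>M1\<^esub> x) \<oplus>\<^bsub>M2\<^esub> (\<ominus>\<^bsub>M2\<^esub> z))"
      have "?b \<in> carrier ?M"
        using a M2.submoduleE(3)[OF ideal_smult_submodule]
        by (auto simp: amalg_module_simps(1))
      moreover have "?b \<oplus>\<^bsub>?M\<^esub> a = \<zero>\<^bsub>?M\<^esub>"
        using a ideal_smult_carrier[of z] phi_closed[of x]
        by (simp add: amalg_module_simps(2,3) phi_neg M1.M.l_neg M2.M.minus_add[symmetric]
            M2.M.l_neg)
      ultimately show ?thesis by blast
    qed
  qed (auto simp: add_closed, auto simp: amalg_module_simps(2,3) amalg_module_carrier_iff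
      M1.M.add.m_ac M2.M.add.m_ac)
  show "a \<odot>\<^bsub>?M\<^esub> b \<in> carrier ?M" if ma: "a \<in> carrier ?A" and mb: "b \<in> carrier ?M" for a b
  proof -
    obtain r j where a: "a = (r, f r \<oplus>\<^bsub>R2\<^esub> j)" "r \<in> carrier R1" "j \<in> J"
      using ma by (auto simp: amalg_ring_simps)
    obtain x z where b: "b = (x, \<phi> x \<oplus>\<^bsub>M2\<^esub> z)" "x \<in> carrier M1" "z \<in> ideal_smult J M2"
      using mb by (auto simp: amalg_module_simps)
    have c: "j \<in> carrier R2" "z \<in> carrier M2" "\<phi> x \<in> carrier M2" "\<phi> (r \<odot>\<^bsub>M1\<^esub> x) \<in> carrier M2"
      using a b by (auto simp: J.Icarr ideal_smult_carrier phi_closed)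
    have "a \<odot>\<^bsub>?M\<^esub> b = (r \<odot>\<^bsub>M1\<^esub> x,
        \<phi> (r \<odot>\<^bsub>M1\<^esub> x) \<oplus>\<^bsub>M2\<^esub> (f r \<odot>\<^bsub>M2\<^esub> z \<oplus>\<^bsub>M2\<^esub> j \<odot>\<^bsub>M2\<^esub> \<phi> x \<oplus>\<^bsub>M2\<^esub> j \<odot>\<^bsub>M2\<^esub> z))"
      using a b c by (simp add: amalg_module_smult M2.M.add.m_assoc)
    moreover have "f r \<odot>\<^bsub>M2\<^esub> z \<oplus>\<^bsub>M2\<^esub> j \<odot>\<^bsub>M2\<^esub> \<phi> x \<oplus>\<^bsub>M2\<^esub> j \<odot>\<^bsub>M2\<^esub> z \<in> ideal_smult J M2"
      using a b c by (intro ideal_smult.sum) (auto intro: ideal_smult_smult ideal_smult.smult)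
    ultimately show ?thesis using a b by (auto simp: amalg_module_simps(1))
  qed
qed (auto simp: amalg_ring_carrier_iff amalg_module_carrier_iff amalg_ring_simps(2-)
    amalg_module_simps(2-) amalg_smult_component M1.smult_l_distr M2.smult_l_distr
    M1.smult_r_distr M2.smult_r_distr M1.smult_assoc1 M2.smult_assoc1)

end

end

theory Submission
  imports Defs
begin

text \<open>
  The projection \<open>(x, y) \<mapsto> y\<close> from \<open>M\<^sub>1 \<Join>\<^sup>\<phi> J M\<^sub>2\<close> to \<open>M\<^sub>2\<close> is additive, and it is semilinear along the
  projection \<open>(r, s) \<mapsto> s\<close> from \<open>R\<^sub>1 \<Join>\<^sup>f J\<close> to \<open>R\<^sub>2\<close>, because the scalar product of the amalgamated
  module is the componentwise one. Both projections are surjective when \<open>f\<close> and \<open>\<phi>\<close> are: they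
  already map the graphs of \<open>f\<close> and \<open>\<phi>\<close> onto \<open>R\<^sub>2\<close> and \<open>M\<^sub>2\<close>. The submodule built from \<open>N\<^sub>2\<close> is the
  preimage of \<open>N\<^sub>2\<close>, and primeness is both preserved and reflected by preimages along surjective
  semilinear maps (\<open>prime_submodule_preimage_iff\<close>). This gives the equivalence.

  For the second claim, the equivalence makes \<open>N\<^sub>2\<close> itself prime. Some \<open>j \<in> J\<close> does not multiply
  \<open>M\<^sub>2\<close> into \<open>N\<^sub>2\<close>, so by primeness \<open>j x \<in> N\<^sub>2\<close> forces \<open>x \<in> N\<^sub>2\<close>. Hence \<open>(N\<^sub>2 : J)\<close> is just \<open>N\<^sub>2\<close>
  (\<open>prime_submodule_module_colon_eq\<close>).
\<close>

lemma submodule_preimage: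
  assumes M: "module R M" and N: "module S N"
    and p_hom: "p \<in> hom (add_monoid M) (add_monoid N)"
    and q_closed: "\<And>r. r \<in> carrier R \<Longrightarrow> q r \<in> carrier S"
    and p_smult: "\<And>r x. r \<in> carrier R \<Longrightarrow> x \<in> carrier M \<Longrightarrow> p (r \<odot>\<^bsub>M\<^esub> x) = q r \<odot>\<^bsub>N\<^esub> p x"
    and P: "submodule P S N"
  shows "submodule {x \<in> carrier M. p x \<in> P} R M"
proof -
  interpret M: module R M by (rule M)
  interpret N: module S N by (rule N)
  interpret p: abelian_group_hom M N p
    by (intro abelian_group_homI group_hom.intro group_hom_axioms.intro)
      (use p_hom in \<open>auto intro: M.abelian_group_axioms N.abelian_group_axioms
        M.M.a_group N.M.a_group\<close>)
  note P_closed = N.submoduleE[OF P]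
  show ?thesis
  proof (rule M.submoduleI)
    show "\<zero>\<^bsub>M\<^esub> \<in> {x \<in> carrier M. p x \<in> P}"
      using submodule.axioms(1)[OF P] subgroup.one_closed[of P "add_monoid N"] by simp
  qed (use P_closed q_closed in \<open>auto simp: p_smult\<close>)
qed

text \<open>
  Surjectivity of \<open>p\<close> identifies the ring colon of the preimage with the preimage of the ring colon
  and keeps properness; surjectivity of \<open>q\<close> lets a product \<open>s y\<close> in \<open>N\<close> be lifted to a product in
  \<open>M\<close>. So the primeness condition for the preimage is the one for \<open>P\<close>, read along \<open>q\<close> and \<open>p\<close>.
\<close>

lemma prime_submodule_preimage_iff:
  assumes M: "module R M" and N: "module S N"
    and p_hom: "p \<in> hom (add_monoid M) (add_monoid N)"
    and p_surj: "p ` carrier M = carrier N" and q_surj: "q ` carrier R = carrier S"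
    and p_smult: "\<And>r x. r \<in> carrier R \<Longrightarrow> x \<in> carrier M \<Longrightarrow> p (r \<odot>\<^bsub>M\<^esub> x) = q r \<odot>\<^bsub>N\<^esub> p x"
    and P: "submodule P S N"
  shows "prime_submodule {x \<in> carrier M. p x \<in> P} R M \<longleftrightarrow> prime_submodule P S N"
proof -
  let ?Q = "{x \<in> carrier M. p x \<in> P}"
  interpret M: module R M by (rule M)
  have sub: "submodule ?Q R M"
    by (rule submodule_preimage[OF M N p_hom _ p_smult P]) (use q_surj in auto)
  have "P \<subseteq> carrier N" by (rule module.submoduleE(1)[OF N P])
  then have proper: "?Q \<noteq> carrier M \<longleftrightarrow> P \<noteq> carrier N"
    unfolding p_surj[symmetric] by blast
  have colon: "r \<in> ring_colon R M ?Q \<longleftrightarrow> q r \<in> ring_colon S N P" if "r \<in> carrier R" for r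
    using that q_surj by (auto simp: ring_colon_def p_surj[symmetric] p_smult)
  have "(\<forall>r \<in> carrier R. \<forall>x \<in> carrier M. r \<odot>\<^bsub>M\<^esub> x \<in> ?Q \<longrightarrow> r \<in> ring_colon R M ?Q \<or> x \<in> ?Q) \<longleftrightarrow>
      (\<forall>s \<in> q ` carrier R. \<forall>y \<in> p ` carrier M.
        s \<odot>\<^bsub>N\<^esub> y \<in> P \<longrightarrow> s \<in> ring_colon S N P \<or> y \<in> P)"
    by (simp add: p_smult colon)
  then show ?thesis
    by (simp only: prime_submodule_def sub P proper p_surj q_surj)
qed

lemma prime_submodule_module_colon_eq:
  assumes M: "module R M" and prime: "prime_submodule N R M"
    and J: "J \<subseteq> carrier R" "\<not> J \<subseteq> ring_colon R M N"
  shows "module_colon M N J = N"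
proof -
  obtain j where "j \<in> J" "j \<notin> ring_colon R M N" using J(2) by auto
  then have "module_colon M N J \<subseteq> N"
    using prime J(1) unfolding prime_submodule_def module_colon_def by blast
  moreover have "submodule N R M" using prime by (simp add: prime_submodule_def)
  then have "N \<subseteq> module_colon M N J"
    using J(1) module.submoduleE(1,4)[OF M] by (fastforce simp: module_colon_def)
  ultimately show ?thesis by blast
qed

context amalg_setup
begin

lemma snd_amalg_ring_surj:
  assumes "f ` carrier R1 = carrier R2"
  shows "snd ` carrier (amalg_ring R1 R2 f J) = carrier R2"
proof -
  have graph: "(r, f r) \<in> carrier (amalg_ring R1 R2 f J)" if "r \<in> carrier R1" for r
    using that by (simp add: amalg_ring_carrier_iff a_minus_def f.S.r_neg)
  have "f r \<in> snd ` carrier (amalg_ring R1 R2 f J)" if "r \<in> carrier R1" for r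
    using imageI[OF graph[OF that], of snd] by simp
  then show ?thesis
    by (auto simp: amalg_ring_carrier_iff simp flip: assms)
qed

lemma snd_amalg_module_surj:
  assumes "\<phi> ` carrier M1 = carrier M2"
  shows "snd ` carrier (amalg_module R2 M1 M2 f J \<phi>) = carrier M2"
proof -
  have graph: "(x, \<phi> x) \<in> carrier (amalg_module R2 M1 M2 f J \<phi>)" if "x \<in> carrier M1" for x
    using that
    by (simp add: amalg_module_carrier_iff a_minus_def M2.M.r_neg phi_closed zero_in_ideal_smult)
  have "\<phi> x \<in> snd ` carrier (amalg_module R2 M1 M2 f J \<phi>)" if "x \<in> carrier M1" for x
    using imageI[OF graph[OF that], of snd] by simp
  then show ?thesis
    by (auto simp: amalg_module_carrier_iff simp flip: assms)
qed

lemma prime_amalg_submodule_iff: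
  assumes "f ` carrier R1 = carrier R2" and "\<phi> ` carrier M1 = carrier M2"
    and "submodule N2 R2 M2"
  shows "prime_submodule (amalg_submodule R2 M1 M2 f J \<phi> N2)
      (amalg_ring R1 R2 f J) (amalg_module R2 M1 M2 f J \<phi>) \<longleftrightarrow> prime_submodule N2 R2 M2"
proof -
  let ?A = "amalg_ring R1 R2 f J" and ?M = "amalg_module R2 M1 M2 f J \<phi>"
  have hom: "snd \<in> hom (add_monoid ?M) (add_monoid M2)"
    by (auto simp: hom_def amalg_module_carrier_iff amalg_module_simps(2))
  have smult: "snd (a \<odot>\<^bsub>?M\<^esub> u) = snd a \<odot>\<^bsub>M2\<^esub> snd u"
    if "a \<in> carrier ?A" "u \<in> carrier ?M" for a u
    using that
    by (cases a; cases u)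
      (simp add: amalg_ring_carrier_iff amalg_module_carrier_iff amalg_smult_component)
  have "amalg_submodule R2 M1 M2 f J \<phi> N2 = {u \<in> carrier ?M. snd u \<in> N2}"
    by (auto simp: amalg_submodule_def)
  then show ?thesis
    using prime_submodule_preimage_iff[OF amalg_module_module M2.module_axioms hom
        snd_amalg_module_surj[OF assms(2)] snd_amalg_ring_surj[OF assms(1)] smult assms(3)]
    by simp
qed

end

theorem corollary5:
  fixes R1 :: "('a, 'k) ring_scheme" and R2 :: "('b, 'l) ring_scheme"
    and M1 :: "('a, 'c, 'm) module_scheme" and M2 :: "('b, 'd, 'n) module_scheme"
    and f :: "'a \<Rightarrow> 'b" and J :: "'b set" and \<phi> :: "'c \<Rightarrow> 'd" and N2 :: "'d set"
  assumes "cring R1" and "\<one>\<^bsub>R1\<^esub> \<noteq> \<zero>\<^bsub>R1\<^esub>"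
    and "cring R2" and "\<one>\<^bsub>R2\<^esub> \<noteq> \<zero>\<^bsub>R2\<^esub>"
    and "f \<in> ring_hom R1 R2" and "f ` carrier R1 = carrier R2"
    and "ideal J R2"
    and "module R1 M1" and "module R2 M2"
    and "\<phi> \<in> mod_hom R1 M1 (restrict_scalars f M2)" and "\<phi> ` carrier M1 = carrier M2"
    and "submodule N2 R2 M2"
  shows "(prime_submodule N2 R2 M2 \<longleftrightarrow>
          prime_submodule (amalg_submodule R2 M1 M2 f J \<phi> N2)
            (amalg_ring R1 R2 f J) (amalg_module R2 M1 M2 f J \<phi>))
    \<and> (prime_submodule (amalg_submodule R2 M1 M2 f J \<phi> N2)
          (amalg_ring R1 R2 f J) (amalg_module R2 M1 M2 f J \<phi>)
        \<and> \<not> J \<subseteq> ring_colon R2 M2 N2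
        \<longrightarrow> prime_submodule (module_colon M2 N2 J) R2 M2)"
proof -
  interpret R1: cring R1 by fact
  interpret R2: cring R2 by fact
  interpret f: ring_hom_cring R1 R2 f
    by unfold_locales fact
  interpret amalg_setup R1 R2 f J M1 M2 \<phi>
    by (intro amalg_setup.intro amalg_setup_axioms.intro f.ring_hom_cring_axioms) fact+
  have iff: "prime_submodule (amalg_submodule R2 M1 M2 f J \<phi> N2)
      (amalg_ring R1 R2 f J) (amalg_module R2 M1 M2 f J \<phi>) \<longleftrightarrow> prime_submodule N2 R2 M2"
    by (rule prime_amalg_submodule_iff) fact+
  have "J \<subseteq> carrier R2" by (auto intro: J.Icarr)
  then show ?thesis
    using iff prime_submodule_module_colon_eq[OF \<open>module R2 M2\<close>, of N2 J] by auto
qed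

end
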